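(* Let $(S,\cdot,D,R)$ be an Ehresmann semigroup. Consider the following conditions on a partial order $\leq$ on $S$: (OS4A) for all $s,t\in S$, if $s\leq t$ and $D(s)=D(t)$ then $s=t$; (OS4B) for all $s,t\in S$, if $s\leq t$ and $R(s)=R(t)$ then $s=t$. If $(S,\cdot,D,R)$ is a left restriction semigroup with range (respectively, a right restriction semigroup with domain), then the Ehresmann order $\leq_e$ on $(S,\cdot,D,R)$ satisfies (OS4A) (respectively, (OS4B)). Conversely, if $(S,\cdot,D,R,\leq)$ is an ordered Ehresmann semigroup satisfying (OS4A) (respectively, (OS4B)), then $(S,\cdot,D,R)$ is a left restriction semigroup with range (respectively, a right restriction semigroup with domain) in which $\leq$ equals $\leq_e$. Hence if $(S,\cdot,D,R)$ is a restriction semigroup, then $(S,\cdot,D,R,\leq_e)$ is an ordered Ehresmann semigroup satisfying (OS4A) and (OS4B). Conversely, if $(S,\cdot,D,R,\leq)$ is an ordered Ehresmann semigroup satisfying (OS4A) and (OS4B), then $(S,\cdot,D,R)$ is a restriction semigroup in which $\leq$ equals $\leq_e$.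
   Context: An Ehresmann semigroup is a semigroup $(S,\cdot)$ with unary operations $D,R$ such that for all $s,t\in S$: $D(s)s=s$, $sR(s)=s$; $D(R(s))=R(s)$, $R(D(s))=D(s)$; $D(st)=D(sD(t))$, $R(st)=R(R(s)t)$; $D(D(s)D(t))=D(s)D(t)$; $D(s)D(t)=D(t)D(s)$. Put $D(S)=\{D(s)\mid s\in S\}=R(S)$. An ordered Ehresmann semigroup $(S,\cdot,D,R,\leq)$ is an Ehresmann semigroup with a partial order $\leq$ on $S$ such that: $a\leq b$ implies $D(a)\leq D(b)$ and $R(a)\leq R(b)$; $a\leq b$ and $c\leq d$ imply $ac\leq bd$; $ae\leq a$ and $ea\leq a$ for all $a\in S$, $e\in D(S)$; and if $a\in S$, $e\in D(S)$ and $a\leq e$ then $a\in D(S)$. Such a partial order is called an Ehresmann order. On an Ehresmann semigroup define partial orders: $s\leq_l t$ iff $s=D(s)t$; $s\leq_r t$ iff $s=tR(s)$. These permute as relations, and $\leq_e$ denotes their join, $\leq_e\,=\,\leq_l\circ\leq_r\,=\,\leq_r\circ\leq_l$, which is a partial order. A left restriction semigroup with range is an Ehresmann semigroup satisfying the law $sD(t)=D(st)s$. Dually, a right restriction semigroup with domain is an Ehresmann semigroup satisfying the law $R(s)t=tR(st)$. A restriction semigroup is an Ehresmann semigroup which is both a left restriction semigroup with range and a right restriction semigroup with domain. (On each of these, $\leq_e$ is an Ehresmann order.) *)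

theory Defs
  imports Main
begin

locale ehresmann_semigroup = semigroup mult
  for mult :: "'a \<Rightarrow> 'a \<Rightarrow> 'a" (infixl "\<cdot>" 70) +
  fixes D R :: "'a \<Rightarrow> 'a"
  assumes D_left_id: "D s \<cdot> s = s"
    and R_right_id: "s \<cdot> R s = s"
    and D_R: "D (R s) = R s"
    and R_D: "R (D s) = D s"
    and D_mult: "D (s \<cdot> t) = D (s \<cdot> D t)"
    and R_mult: "R (s \<cdot> t) = R (R s \<cdot> t)"
    and D_closed: "D (D s \<cdot> D t) = D s \<cdot> D t"
    and D_commute: "D s \<cdot> D t = D t \<cdot> D s"

locale left_restriction_semigroup_with_range = ehresmann_semigroup +
  assumes left_law: "s \<cdot> D t = D (s \<cdot> t) \<cdot> s"

locale right_restriction_semigroup_with_domain = ehresmann_semigroup +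
  assumes right_law: "R s \<cdot> t = t \<cdot> R (s \<cdot> t)"

locale restriction_semigroup =
  left_restriction_semigroup_with_range + right_restriction_semigroup_with_domain

text \<open>Orders are relations, with \<open>(s, t) \<in> le\<close> meaning \<open>s \<le> t\<close>. The set of
  projections \<open>D(S)\<close> is \<open>range D\<close>, which coincides with \<open>range R\<close>
  (\<open>range_D_eq_range_R\<close> below).\<close>

locale ordered_ehresmann_semigroup = ehresmann_semigroup +
  fixes le :: "('a \<times> 'a) set"
  assumes le_partial_order: "partial_order_on UNIV le"
    and le_D: "(a, b) \<in> le \<Longrightarrow> (D a, D b) \<in> le"
    and le_R: "(a, b) \<in> le \<Longrightarrow> (R a, R b) \<in> le"
    and le_mult: "(a, b) \<in> le \<Longrightarrow> (c, d) \<in> le \<Longrightarrow> (a \<cdot> c, b \<cdot> d) \<in> le"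
    and le_proj_right: "e \<in> range D \<Longrightarrow> (a \<cdot> e, a) \<in> le"
    and le_proj_left: "e \<in> range D \<Longrightarrow> (e \<cdot> a, a) \<in> le"
    and below_proj: "e \<in> range D \<Longrightarrow> (a, e) \<in> le \<Longrightarrow> a \<in> range D"

definition leq_l :: "('a \<Rightarrow> 'a \<Rightarrow> 'a) \<Rightarrow> ('a \<Rightarrow> 'a) \<Rightarrow> ('a \<times> 'a) set" where
  "leq_l mult D = {(s, t). s = mult (D s) t}"

definition leq_r :: "('a \<Rightarrow> 'a \<Rightarrow> 'a) \<Rightarrow> ('a \<Rightarrow> 'a) \<Rightarrow> ('a \<times> 'a) set" where
  "leq_r mult R = {(s, t). s = mult t (R s)}"

text \<open>On an Ehresmann semigroup the two factors commute and \<open>leq_e\<close> is a partial order, the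
  join of \<open>leq_l\<close> and \<open>leq_r\<close>; see \<open>leq_l_leq_r_permute\<close>, \<open>partial_order_leq_e\<close> and
  \<open>leq_e_join\<close> below.\<close>

definition leq_e :: "('a \<Rightarrow> 'a \<Rightarrow> 'a) \<Rightarrow> ('a \<Rightarrow> 'a) \<Rightarrow> ('a \<Rightarrow> 'a) \<Rightarrow> ('a \<times> 'a) set" where
  "leq_e mult D R = leq_l mult D O leq_r mult R"

definition OS4A :: "('a \<Rightarrow> 'a) \<Rightarrow> ('a \<times> 'a) set \<Rightarrow> bool" where
  "OS4A D le \<longleftrightarrow> (\<forall>s t. (s, t) \<in> le \<and> D s = D t \<longrightarrow> s = t)"

definition OS4B :: "('a \<Rightarrow> 'a) \<Rightarrow> ('a \<times> 'a) set \<Rightarrow> bool" where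
  "OS4B R le \<longleftrightarrow> (\<forall>s t. (s, t) \<in> le \<and> R s = R t \<longrightarrow> s = t)"

context ehresmann_semigroup
begin

lemma range_D_eq_range_R: "range D = range R"
proof (intro subset_antisym subsetI)
  show "x \<in> range R" if "x \<in> range D" for x
    using that R_D by (metis imageE rangeI)
  show "x \<in> range D" if "x \<in> range R" for x
    using that D_R by (metis imageE rangeI)
qed

lemma D_D: "D (D s) = D s"
  by (metis D_R R_D)

lemma R_R: "R (R s) = R s"
  by (metis D_R R_D)

lemma R_closed: "R (R s \<cdot> R t) = R s \<cdot> R t"
  by (metis D_R R_D D_closed)

lemma D_proj_mult: "D (D s \<cdot> t) = D s \<cdot> D t"
  by (metis D_mult D_closed)

lemma R_mult_proj: "R (s \<cdot> R t) = R s \<cdot> R t"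
  by (metis R_mult R_closed)

lemma R_commute: "R s \<cdot> R t = R t \<cdot> R s"
  by (metis D_R D_commute)

lemma D_idem: "D s \<cdot> D s = D s"
  by (metis D_D D_left_id)

lemma R_idem: "R s \<cdot> R s = R s"
  by (metis R_R R_right_id)

lemma mem_leq_l_iff: "(s, t) \<in> leq_l (\<cdot>) D \<longleftrightarrow> (\<exists>e. s = D e \<cdot> t)"
  unfolding leq_l_def
  by simp (metis D_proj_mult D_left_id assoc)

lemma mem_leq_r_iff: "(s, t) \<in> leq_r (\<cdot>) R \<longleftrightarrow> (\<exists>e. s = t \<cdot> R e)"
  unfolding leq_r_def
  by simp (metis R_mult_proj R_right_id assoc)

lemma mem_leq_e_iff: "(s, t) \<in> leq_e (\<cdot>) D R \<longleftrightarrow> (\<exists>e f. s = D e \<cdot> t \<cdot> R f)"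
  unfolding leq_e_def relcomp_unfold mem_Collect_eq case_prod_conv mem_leq_l_iff mem_leq_r_iff assoc
  by blast

lemma leq_l_leq_r_permute:
  "leq_l (\<cdot>) D O leq_r (\<cdot>) R = leq_r (\<cdot>) R O leq_l (\<cdot>) D"
proof -
  have "(s, t) \<in> leq_r (\<cdot>) R O leq_l (\<cdot>) D \<longleftrightarrow> (s, t) \<in> leq_e (\<cdot>) D R" for s t
    unfolding mem_leq_e_iff relcomp_unfold mem_Collect_eq case_prod_conv mem_leq_l_iff mem_leq_r_iff
    by blast
  then show ?thesis unfolding leq_e_def by auto
qed

lemma D_D_mult: "D t \<cdot> D (t \<cdot> u) = D (t \<cdot> u)"
  by (metis D_proj_mult D_left_id assoc)

lemma R_mult_R: "R (u \<cdot> t) \<cdot> R t = R (u \<cdot> t)"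
  by (metis R_mult_proj R_right_id assoc)

lemma leq_e_mono_eq:
  assumes "(s, t) \<in> leq_e (\<cdot>) D R"
  shows "D s \<cdot> D t = D s" "R s \<cdot> R t = R s" "s = D s \<cdot> t \<cdot> R s"
proof -
  obtain e f where s: "s = D e \<cdot> t \<cdot> R f"
    using assms unfolding mem_leq_e_iff by blast
  have Ds: "D s = D e \<cdot> D (t \<cdot> R f)" by (simp add: s D_proj_mult assoc)
  have Rs: "R s = R (D e \<cdot> t) \<cdot> R f" by (simp add: s R_mult_proj)
  show "D s \<cdot> D t = D s"
    unfolding Ds by (simp only: assoc D_commute[of _ t] D_D_mult)
  show "R s \<cdot> R t = R s"
    unfolding Rs by (simp only: assoc R_commute[of f t]) (simp only: R_mult_R flip: assoc)
  have De: "D s \<cdot> D e = D s"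
    unfolding Ds by (simp only: assoc D_commute[of _ e]) (simp only: D_idem flip: assoc)
  have Rf: "R f \<cdot> R s = R s"
    unfolding Rs by (simp only: R_commute[of _ f]) (simp only: R_idem flip: assoc)
  have "s = D s \<cdot> s \<cdot> R s" by (simp add: D_left_id R_right_id)
  also have "\<dots> = (D s \<cdot> D e) \<cdot> t \<cdot> (R f \<cdot> R s)"
    by (subst (2) s) (simp only: assoc)
  finally show "s = D s \<cdot> t \<cdot> R s" by (simp only: De Rf)
qed

lemma partial_order_leq_e: "partial_order_on UNIV (leq_e (\<cdot>) D R)"
proof -
  have refl: "(s, s) \<in> leq_e (\<cdot>) D R" for s
    unfolding mem_leq_e_iff by (metis D_left_id R_right_id)
  have trans: "(s, u) \<in> leq_e (\<cdot>) D R"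
    if "(s, t) \<in> leq_e (\<cdot>) D R" "(t, u) \<in> leq_e (\<cdot>) D R" for s t u
  proof -
    obtain e f where s: "s = D e \<cdot> t \<cdot> R f" using \<open>(s, t) \<in> _\<close> unfolding mem_leq_e_iff by blast
    obtain g h where t: "t = D g \<cdot> u \<cdot> R h" using \<open>(t, u) \<in> _\<close> unfolding mem_leq_e_iff by blast
    have "s = D (D e \<cdot> D g) \<cdot> u \<cdot> R (R h \<cdot> R f)"
      by (simp add: s t D_closed R_closed assoc)
    then show ?thesis unfolding mem_leq_e_iff by blast
  qed
  have antisym: "s = t"
    if st: "(s, t) \<in> leq_e (\<cdot>) D R" and ts: "(t, s) \<in> leq_e (\<cdot>) D R" for s t
  proof -
    have "D s = D t" using leq_e_mono_eq(1)[OF st] leq_e_mono_eq(1)[OF ts] D_commute by metis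
    moreover have "R s = R t"
      using leq_e_mono_eq(2)[OF st] leq_e_mono_eq(2)[OF ts] R_commute by metis
    ultimately show ?thesis using leq_e_mono_eq(3)[OF st] by (simp add: D_left_id R_right_id)
  qed
  show ?thesis
    unfolding partial_order_on_def preorder_on_def refl_on_def
    using refl trans antisym by (auto intro!: transI antisymI)
qed

lemma leq_e_join:
  "leq_l (\<cdot>) D \<subseteq> leq_e (\<cdot>) D R"
  "leq_r (\<cdot>) R \<subseteq> leq_e (\<cdot>) D R"
  "\<lbrakk>trans q; leq_l (\<cdot>) D \<subseteq> q; leq_r (\<cdot>) R \<subseteq> q\<rbrakk> \<Longrightarrow> leq_e (\<cdot>) D R \<subseteq> q"
proof -
  have "(s, s) \<in> leq_l (\<cdot>) D" "(s, s) \<in> leq_r (\<cdot>) R" for s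
    by (simp_all add: leq_l_def leq_r_def D_left_id R_right_id)
  then show "leq_l (\<cdot>) D \<subseteq> leq_e (\<cdot>) D R" "leq_r (\<cdot>) R \<subseteq> leq_e (\<cdot>) D R"
    unfolding leq_e_def by auto
  show "leq_e (\<cdot>) D R \<subseteq> q" if "trans q" "leq_l (\<cdot>) D \<subseteq> q" "leq_r (\<cdot>) R \<subseteq> q"
    unfolding leq_e_def using that by (auto dest: transD)
qed

end

end

theory Submission
  imports Defs
begin

text \<open>
  On any Ehresmann semigroup \<open>\<le>\<^sub>e\<close> satisfies every axiom of an Ehresmann order except possibly
  compatibility with multiplication. The law \<open>s D(t) = D(st) s\<close> moves projections from the right of
  an element to its left, so it collapses \<open>\<le>\<^sub>e\<close> to \<open>\<le>\<^sub>l\<close>. Compatibility follows by pulling the inner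
  projection of \<open>D(a) b D(c) d\<close> to the front, and (OS4A) is immediate, since \<open>s \<le>\<^sub>l t\<close> means
  \<open>s = D(s) t\<close>.

  Conversely, an Ehresmann order restricts to the semilattice order on projections. Hence \<open>s \<le> t\<close>
  yields \<open>s = D(s) s \<le> D(s) t\<close>, where both ends have the same \<open>D\<close>, and \<open>s D(t) \<le> s\<close> yields
  \<open>s D(t) \<le> D(st) s\<close>, where again both ends have the same \<open>D\<close>. Under (OS4A) both inequalities become
  equalities: the first shows that \<open>\<le>\<close> lies inside \<open>\<le>\<^sub>l\<close>, the second is the left restriction law.
  The inclusion of \<open>\<le>\<^sub>e\<close> in \<open>\<le>\<close> holds for every Ehresmann order.

  Reversing the multiplication and exchanging \<open>D\<close> with \<open>R\<close> turns each Ehresmann semigroup into another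
  one with the same \<open>\<le>\<^sub>e\<close>, so the right-handed statements are the left-handed ones for the dual.
\<close>

section \<open>The natural order as an Ehresmann order\<close>

context ehresmann_semigroup
begin

text \<open>Compatibility with \<open>\<cdot>\<close> is the only axiom of an Ehresmann order that can fail for \<open>\<le>\<^sub>e\<close>:
  monotonicity of \<open>D\<close> and \<open>R\<close> comes down to \<open>s \<le>\<^sub>e t\<close> forcing \<open>D(s) D(t) = D(s)\<close> and
  \<open>R(s) R(t) = R(s)\<close>, and an element below a projection is a product of three projections.\<close>

lemma ordered_leq_e_if_compatible:
  assumes mono: "\<And>a b c d. (a, b) \<in> leq_e (\<cdot>) D R \<Longrightarrow> (c, d) \<in> leq_e (\<cdot>) D R
      \<Longrightarrow> (a \<cdot> c, b \<cdot> d) \<in> leq_e (\<cdot>) D R"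
  shows "ordered_ehresmann_semigroup (\<cdot>) D R (leq_e (\<cdot>) D R)"
proof unfold_locales
  show "partial_order_on UNIV (leq_e (\<cdot>) D R)" by (rule partial_order_leq_e)
  show "(D a, D b) \<in> leq_e (\<cdot>) D R" if "(a, b) \<in> leq_e (\<cdot>) D R" for a b
    using leq_e_mono_eq(1)[OF that] leq_e_join(1) mem_leq_l_iff by (metis subsetD)
  show "(R a, R b) \<in> leq_e (\<cdot>) D R" if "(a, b) \<in> leq_e (\<cdot>) D R" for a b
    using leq_e_mono_eq(2)[OF that] leq_e_join(2) mem_leq_r_iff R_commute by (metis subsetD)
  show "(a \<cdot> c, b \<cdot> d) \<in> leq_e (\<cdot>) D R"
    if "(a, b) \<in> leq_e (\<cdot>) D R" "(c, d) \<in> leq_e (\<cdot>) D R" for a b c d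
    using that by (rule mono)
  show "(a \<cdot> e, a) \<in> leq_e (\<cdot>) D R" if "e \<in> range D" for a e
    using that leq_e_join(2) mem_leq_r_iff unfolding range_D_eq_range_R by blast
  show "(e \<cdot> a, a) \<in> leq_e (\<cdot>) D R" if "e \<in> range D" for a e
    using that leq_e_join(1) mem_leq_l_iff by blast
  show "a \<in> range D" if e: "e \<in> range D" and le: "(a, e) \<in> leq_e (\<cdot>) D R" for a e
  proof -
    obtain x where "e = D x" using e by blast
    moreover obtain g f where "a = D g \<cdot> e \<cdot> R f" using le unfolding mem_leq_e_iff by blast
    ultimately have "a = D (D g \<cdot> D x) \<cdot> D (R f)" by (simp only: D_closed D_R)
    then have "a = D (D (D g \<cdot> D x) \<cdot> D (R f))"
      by (rule trans[OF _ D_closed[symmetric]])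
    then show ?thesis by blast
  qed
qed

end

context left_restriction_semigroup_with_range
begin

text \<open>A projection on the right can be moved to the left, so \<open>D(e) t R(f)\<close> is already
  a left restriction of \<open>t\<close>.\<close>

lemma leq_e_eq_leq_l: "leq_e (\<cdot>) D R = leq_l (\<cdot>) D"
proof
  show "leq_e (\<cdot>) D R \<subseteq> leq_l (\<cdot>) D"
  proof (rule subrelI)
    fix s t assume "(s, t) \<in> leq_e (\<cdot>) D R"
    then obtain e f where "s = D e \<cdot> t \<cdot> R f" unfolding mem_leq_e_iff by blast
    also have "\<dots> = D e \<cdot> (t \<cdot> D (R f))" by (simp only: D_R assoc)
    also have "\<dots> = D (D e \<cdot> D (t \<cdot> R f)) \<cdot> t" by (simp only: left_law[of t] D_closed assoc)
    finally show "(s, t) \<in> leq_l (\<cdot>) D" unfolding mem_leq_l_iff by blast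
  qed
qed (rule leq_e_join(1))

lemma leq_l_mult:
  assumes "(a, b) \<in> leq_l (\<cdot>) D" "(c, d) \<in> leq_l (\<cdot>) D"
  shows "(a \<cdot> c, b \<cdot> d) \<in> leq_l (\<cdot>) D"
proof -
  obtain e f where "a = D e \<cdot> b" "c = D f \<cdot> d"
    using assms unfolding mem_leq_l_iff by blast
  then have "a \<cdot> c = D e \<cdot> (b \<cdot> D f) \<cdot> d" by (simp only: assoc)
  also have "\<dots> = D (D e \<cdot> D (b \<cdot> f)) \<cdot> (b \<cdot> d)"
    by (simp only: left_law[of b] D_closed assoc)
  finally show ?thesis unfolding mem_leq_l_iff by blast
qed

lemma ordered_leq_e: "ordered_ehresmann_semigroup (\<cdot>) D R (leq_e (\<cdot>) D R)"
  by (rule ordered_leq_e_if_compatible) (simp only: leq_e_eq_leq_l leq_l_mult)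

lemma OS4A_leq_e: "OS4A D (leq_e (\<cdot>) D R)"
  unfolding OS4A_def leq_e_eq_leq_l leq_l_def by (auto simp: D_left_id)

end

section \<open>Ehresmann orders satisfying (OS4A)\<close>

context ordered_ehresmann_semigroup
begin

lemma le_refl: "(a, a) \<in> le"
  using le_partial_order by (simp add: partial_order_on_def preorder_on_def refl_on_def)

lemma le_trans: "(a, b) \<in> le \<Longrightarrow> (b, c) \<in> le \<Longrightarrow> (a, c) \<in> le"
  using le_partial_order by (auto simp: partial_order_on_def preorder_on_def dest: transD)

lemma le_antisym: "(a, b) \<in> le \<Longrightarrow> (b, a) \<in> le \<Longrightarrow> a = b"
  using le_partial_order by (auto simp: partial_order_on_def dest: antisymD)

lemma leq_e_subset_le: "leq_e (\<cdot>) D R \<subseteq> le"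
proof (rule subrelI)
  fix s t assume "(s, t) \<in> leq_e (\<cdot>) D R"
  then obtain e f where s: "s = D e \<cdot> t \<cdot> R f" unfolding mem_leq_e_iff by blast
  have "R f \<in> range D" unfolding range_D_eq_range_R by blast
  then have "(s, D e \<cdot> t) \<in> le" unfolding s by (rule le_proj_right)
  moreover have "(D e \<cdot> t, t) \<in> le" by (rule le_proj_left) blast
  ultimately show "(s, t) \<in> le" by (rule le_trans)
qed

text \<open>On projections an Ehresmann order is the order of the semilattice \<open>D(S)\<close>: multiplying
  \<open>D(s) \<le> D(t)\<close> by \<open>D(s)\<close> gives \<open>D(s) \<le> D(s) D(t)\<close>, and \<open>D(s) D(t) \<le> D(s)\<close> always holds.\<close>

lemma le_imp_D_absorb:
  assumes "(s, t) \<in> le"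
  shows "D s \<cdot> D t = D s"
proof (rule le_antisym)
  show "(D s \<cdot> D t, D s) \<in> le" by (rule le_proj_right) blast
  show "(D s, D s \<cdot> D t) \<in> le"
    using le_mult[OF le_refl le_D[OF assms], of "D s"] by (simp only: D_idem)
qed

lemma OS4A_imp_le_eq_leq_e:
  assumes "OS4A D le"
  shows "le = leq_e (\<cdot>) D R"
proof
  show "le \<subseteq> leq_e (\<cdot>) D R"
  proof (rule subrelI)
    fix s t assume st: "(s, t) \<in> le"
    have "(s, D s \<cdot> t) \<in> le"
      using le_mult[OF le_refl st, of "D s"] by (simp only: D_left_id)
    moreover have "D s = D (D s \<cdot> t)"
      by (simp only: D_proj_mult le_imp_D_absorb[OF st])
    ultimately have "s = D s \<cdot> t" using assms unfolding OS4A_def by blast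
    then have "(s, t) \<in> leq_l (\<cdot>) D" unfolding leq_l_def by simp
    then show "(s, t) \<in> leq_e (\<cdot>) D R" using leq_e_join(1) by blast
  qed
qed (rule leq_e_subset_le)

lemma OS4A_imp_left_restriction:
  assumes "OS4A D le"
  shows "left_restriction_semigroup_with_range (\<cdot>) D R"
proof unfold_locales
  fix s t
  have "(s \<cdot> D t, s) \<in> le" by (rule le_proj_right) blast
  then have "(D (s \<cdot> t) \<cdot> (s \<cdot> D t), D (s \<cdot> t) \<cdot> s) \<in> le" by (rule le_mult[OF le_refl])
  \<comment> \<open>\<open>D(st)\<close> equals \<open>D(s D(t))\<close>, so it fixes the smaller side; this is why \<open>D(st)\<close> is the
    multiplier.\<close>
  moreover have "D (s \<cdot> t) \<cdot> (s \<cdot> D t) = s \<cdot> D t" by (metis D_mult D_left_id)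
  moreover have "D (s \<cdot> D t) = D (D (s \<cdot> t) \<cdot> s)"
    by (metis D_mult D_proj_mult D_commute D_D_mult)
  ultimately show "s \<cdot> D t = D (s \<cdot> t) \<cdot> s" using assms unfolding OS4A_def by simp
qed

end

section \<open>Left-right duality\<close>

context ehresmann_semigroup
begin

lemma dual_ehresmann: "ehresmann_semigroup (\<lambda>x y. y \<cdot> x) R D"
  by unfold_locales
    (fact assoc[symmetric] R_right_id D_left_id R_D D_R R_mult D_mult R_closed R_commute)+

text \<open>The orders \<open>\<le>\<^sub>l\<close> and \<open>\<le>\<^sub>r\<close> trade places in the dual; their join stays the same because they
  permute.\<close>

lemma leq_e_dual: "leq_e (\<lambda>x y. y \<cdot> x) R D = leq_e (\<cdot>) D R"
proof -
  have "leq_e (\<lambda>x y. y \<cdot> x) R D = leq_r (\<cdot>) R O leq_l (\<cdot>) D"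
    by (simp add: leq_e_def leq_l_def leq_r_def)
  then show ?thesis unfolding leq_e_def leq_l_leq_r_permute .
qed

end

lemma ordered_ehresmann_dual:
  assumes "ordered_ehresmann_semigroup mult D R le"
  shows "ordered_ehresmann_semigroup (\<lambda>x y. mult y x) R D le"
proof -
  interpret ordered_ehresmann_semigroup mult D R le by fact
  show ?thesis
    by (intro ordered_ehresmann_semigroup.intro dual_ehresmann
        ordered_ehresmann_semigroup_axioms.intro)
      (simp_all only: le_partial_order le_D le_R le_mult le_proj_left le_proj_right
        range_D_eq_range_R[symmetric] below_proj)
qed

lemma right_restriction_iff_dual_left_restriction:
  assumes "ehresmann_semigroup mult D R"
  shows "right_restriction_semigroup_with_domain mult D R
    \<longleftrightarrow> left_restriction_semigroup_with_range (\<lambda>x y. mult y x) R D"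
  unfolding right_restriction_semigroup_with_domain_def
    left_restriction_semigroup_with_range_def
    right_restriction_semigroup_with_domain_axioms_def
    left_restriction_semigroup_with_range_axioms_def
  using assms ehresmann_semigroup.dual_ehresmann[OF assms] by auto

lemma OS4B_iff_OS4A: "OS4B R le \<longleftrightarrow> OS4A R le"
  unfolding OS4A_def OS4B_def ..

lemma (in right_restriction_semigroup_with_domain) ordered_and_OS4B_leq_e:
  shows "ordered_ehresmann_semigroup mult D R (leq_e mult D R)" and "OS4B R (leq_e mult D R)"
proof -
  have left: "left_restriction_semigroup_with_range (\<lambda>x y. mult y x) R D"
    using right_restriction_iff_dual_left_restriction ehresmann_semigroup_axioms
      right_restriction_semigroup_with_domain_axioms by blast
  show "ordered_ehresmann_semigroup mult D R (leq_e mult D R)"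
    using ordered_ehresmann_dual[OF
        left_restriction_semigroup_with_range.ordered_leq_e[OF left]]
    unfolding leq_e_dual .
  show "OS4B R (leq_e mult D R)"
    using left_restriction_semigroup_with_range.OS4A_leq_e[OF left]
    unfolding leq_e_dual OS4B_iff_OS4A .
qed

lemma (in ordered_ehresmann_semigroup) OS4B_imp_right_restriction_and_le_eq_leq_e:
  assumes "OS4B R le"
  shows "right_restriction_semigroup_with_domain mult D R" and "le = leq_e mult D R"
proof -
  have dual: "ordered_ehresmann_semigroup (\<lambda>x y. mult y x) R D le"
    by (rule ordered_ehresmann_dual) (rule ordered_ehresmann_semigroup_axioms)
  have os: "OS4A R le" using assms unfolding OS4B_iff_OS4A .
  show "right_restriction_semigroup_with_domain mult D R"
    using ordered_ehresmann_semigroup.OS4A_imp_left_restriction[OF dual os]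
    unfolding right_restriction_iff_dual_left_restriction[OF ehresmann_semigroup_axioms] .
  show "le = leq_e mult D R"
    using ordered_ehresmann_semigroup.OS4A_imp_le_eq_leq_e[OF dual os]
    unfolding leq_e_dual .
qed

section \<open>Restriction semigroups as ordered Ehresmann semigroups\<close>

theorem proposition3p14:
  fixes mult :: "'a \<Rightarrow> 'a \<Rightarrow> 'a" and D R :: "'a \<Rightarrow> 'a"
  assumes "ehresmann_semigroup mult D R"
  shows
    "(left_restriction_semigroup_with_range mult D R \<longrightarrow>
        ordered_ehresmann_semigroup mult D R (leq_e mult D R) \<and> OS4A D (leq_e mult D R)) \<and>
     (right_restriction_semigroup_with_domain mult D R \<longrightarrow>
        ordered_ehresmann_semigroup mult D R (leq_e mult D R) \<and> OS4B R (leq_e mult D R)) \<and>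
     (\<forall>le. ordered_ehresmann_semigroup mult D R le \<and> OS4A D le \<longrightarrow>
        left_restriction_semigroup_with_range mult D R \<and> le = leq_e mult D R) \<and>
     (\<forall>le. ordered_ehresmann_semigroup mult D R le \<and> OS4B R le \<longrightarrow>
        right_restriction_semigroup_with_domain mult D R \<and> le = leq_e mult D R) \<and>
     (restriction_semigroup mult D R \<longrightarrow>
        ordered_ehresmann_semigroup mult D R (leq_e mult D R) \<and>
        OS4A D (leq_e mult D R) \<and> OS4B R (leq_e mult D R)) \<and>
     (\<forall>le. ordered_ehresmann_semigroup mult D R le \<and> OS4A D le \<and> OS4B R le \<longrightarrow>
        restriction_semigroup mult D R \<and> le = leq_e mult D R)"
proof (intro conjI impI allI; (elim conjE)?)
  assume "left_restriction_semigroup_with_range mult D R"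
  then interpret left_restriction_semigroup_with_range mult D R .
  show "ordered_ehresmann_semigroup mult D R (leq_e mult D R)" by (rule ordered_leq_e)
  show "OS4A D (leq_e mult D R)" by (rule OS4A_leq_e)
next
  assume "right_restriction_semigroup_with_domain mult D R"
  then interpret right_restriction_semigroup_with_domain mult D R .
  show "ordered_ehresmann_semigroup mult D R (leq_e mult D R)"
    by (rule ordered_and_OS4B_leq_e)
  show "OS4B R (leq_e mult D R)" by (rule ordered_and_OS4B_leq_e)
next
  assume "restriction_semigroup mult D R"
  then interpret restriction_semigroup mult D R .
  show "ordered_ehresmann_semigroup mult D R (leq_e mult D R)" by (rule ordered_leq_e)
  show "OS4A D (leq_e mult D R)" by (rule OS4A_leq_e)
  show "OS4B R (leq_e mult D R)" by (rule ordered_and_OS4B_leq_e)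
next
  fix le assume "ordered_ehresmann_semigroup mult D R le"
  then interpret ordered_ehresmann_semigroup mult D R le .
  show "le = leq_e mult D R" if "OS4A D le"
    using that by (rule OS4A_imp_le_eq_leq_e)
  show left: "left_restriction_semigroup_with_range mult D R" if "OS4A D le"
    using that by (rule OS4A_imp_left_restriction)
  show "le = leq_e mult D R" if "OS4B R le"
    using that by (rule OS4B_imp_right_restriction_and_le_eq_leq_e)
  show right: "right_restriction_semigroup_with_domain mult D R" if "OS4B R le"
    using that by (rule OS4B_imp_right_restriction_and_le_eq_leq_e)
  show "restriction_semigroup mult D R" if "OS4A D le" "OS4B R le"
    using left[OF that(1)] right[OF that(2)] by (rule restriction_semigroup.intro)
  show "le = leq_e mult D R" if "OS4A D le" "OS4B R le"
    using that(1) by (rule OS4A_imp_le_eq_leq_e)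
qed

end
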